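(* Let $S=\begin{bmatrix}Q_1&Q_2\\P_1&P_2\end{bmatrix}\in\mathrm{Sp}(2n,\mathbb{R})$ (with $n\times n$ real blocks), let $j=j_{\mathrm{Sp}}(S)=-SS^\top\mathbb{J}$, which is an $\omega_{\mathbb{R}^{2n}}$-compatible complex structure on $\mathbb{R}^{2n}$, and let $\Gamma^{j}=\frac12(I+ij)\mathbb{R}^{2n}\subset\mathbb{C}^{2n}$ be its $(-i)$-eigenspace, which belongs to the negative Lagrangian Grassmannian. Then the upper half plane coordinate $W_{\Gamma^{j}}$ of $\Gamma^{j}$ is $$W_{\Gamma^{j_{\mathrm{Sp}}(S)}}=(P_1+iP_2)(Q_1+iQ_2)^{-1}.$$
   Context: $\mathbb{J}=\begin{bmatrix}0_n & I_n\\ -I_n & 0_n\end{bmatrix}$, $\omega_{\mathbb{R}^{2n}}(v,w)=v^\top\mathbb{J}w$, extended complex-bilinearly to $\mathbb{C}^{2n}$; $\mathrm{Sp}(2n,\mathbb{R})=\{S : S^\top\mathbb{J}S=\mathbb{J}\}$. An $\omega_{\mathbb{R}^{2n}}$-compatible complex structure is $j\in\mathrm{Sp}(2n,\mathbb{R})$ with $j^2=-I$ and $\omega_{\mathbb{R}^{2n}}(u,ju)>0$ for real $u\neq0$. The negative Lagrangian Grassmannian is the set of complex Lagrangian subspaces $\Gamma\subset\mathbb{C}^{2n}$ on which $s(w,z)=-i\,\omega_{\mathbb{R}^{2n}}(w,\overline z)$ is negative-definite. Let $e_1,\dots,e_{2n}$ be the standard basis, $\Gamma_1=\mathrm{span}_{\mathbb{C}}\{e_1,\dots,e_n\}$,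 $\Gamma_2=\mathrm{span}_{\mathbb{C}}\{e_{n+1},\dots,e_{2n}\}$, and let $p_i:\mathbb{C}^{2n}=\Gamma_1\oplus\Gamma_2\to\Gamma_i$ be the projections. For $\Gamma$ in the negative Lagrangian Grassmannian, $p_1|_\Gamma$ is a bijection onto $\Gamma_1$, and one defines $\widehat W_\Gamma=(p_2|_\Gamma)\circ(p_1|_\Gamma)^{-1}:\Gamma_1\to\Gamma_2$. The upper half plane coordinate of $\Gamma$ is the matrix $W_\Gamma\in\mathrm{M}_n(\mathbb{C})$ with $\widehat W_\Gamma(e_\alpha)=\sum_{\beta=1}^n (W_\Gamma)_{\beta\alpha}e_{n+\beta}$; it lies in the Siegel upper half plane $\{W : W^\top=W,\ \operatorname{Im}W>0\}$. *)

theory Defs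
  imports "HOL-Analysis.Analysis"
begin

text \<open>
  Vectors of length \<open>2n\<close> are indexed by the disjoint sum \<open>'n + 'n\<close>, where \<open>n = CARD('n)\<close>:
  the basis vector \<open>e\<^sub>\<alpha>\<close> is \<open>axis (Inl \<alpha>) 1\<close> and \<open>e\<^sub>n\<^sub>+\<^sub>\<beta>\<close> is \<open>axis (Inr \<beta>) 1\<close>.
\<close>

definition block_mat ::
  "'a^'n^'n \<Rightarrow> 'a^'n^'n \<Rightarrow> 'a^'n^'n \<Rightarrow> 'a^'n^'n \<Rightarrow> 'a^('n::finite + 'n)^('n + 'n)" where
  "block_mat A B C D = (\<chi> i k.
     case i of
       Inl a \<Rightarrow> (case k of Inl b \<Rightarrow> A $ a $ b | Inr b \<Rightarrow> B $ a $ b)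
     | Inr a \<Rightarrow> (case k of Inl b \<Rightarrow> C $ a $ b | Inr b \<Rightarrow> D $ a $ b))"

definition JJ :: "'a::comm_ring_1^('n::finite + 'n)^('n + 'n)" where
  "JJ = block_mat (mat 0) (mat 1) (- mat 1) (mat 0)"

text \<open>
  The form \<open>v\<^sup>T J w\<close> over an arbitrary commutative ring.  Over the complex numbers this is the
  complex-bilinear (not sesquilinear) extension of the real form.
\<close>

definition omega :: "'a::comm_ring_1^('n::finite + 'n) \<Rightarrow> 'a^('n + 'n) \<Rightarrow> 'a" where
  "omega v w = (\<Sum>i\<in>UNIV. v $ i * (JJ *v w) $ i)"

definition Sp :: "(real^('n::finite + 'n)^('n + 'n)) set" where
  "Sp = {S. transpose S ** JJ ** S = JJ}"

definition compatible_complex_structure :: "real^('n::finite + 'n)^('n + 'n) \<Rightarrow> bool" where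
  "compatible_complex_structure j \<longleftrightarrow>
     j \<in> Sp \<and> j ** j = - mat 1 \<and> (\<forall>u. u \<noteq> 0 \<longrightarrow> omega u (j *v u) > 0)"

definition j_Sp :: "real^('n::finite + 'n)^('n + 'n) \<Rightarrow> real^('n + 'n)^('n + 'n)" where
  "j_Sp S = - (S ** transpose S ** JJ)"

definition cvec :: "real^'m \<Rightarrow> complex^'m" where
  "cvec v = (\<chi> i. complex_of_real (v $ i))"

definition cnj_vec :: "complex^'m \<Rightarrow> complex^'m" where
  "cnj_vec z = (\<chi> i. cnj (z $ i))"

abbreviation cmat :: "real^'m::finite^'k::finite \<Rightarrow> complex^'m^'k" where
  "cmat \<equiv> map_matrix complex_of_real"

definition mat_scale :: "'a::times \<Rightarrow> 'a^'m::finite^'k::finite \<Rightarrow> 'a^'m^'k" where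
  "mat_scale c A = map_matrix ((*) c) A"

definition Gamma_of :: "real^('n::finite + 'n)^('n + 'n) \<Rightarrow> (complex^('n + 'n)) set" where
  "Gamma_of j = (\<lambda>v. mat_scale (1/2) (mat 1 + mat_scale \<i> (cmat j)) *v cvec v) ` UNIV"

text \<open>\<open>vec.subspace\<close> and \<open>vec.dim\<close> refer to the complex scalar multiplication \<open>(*s)\<close>.\<close>

definition complex_lagrangian :: "(complex^('n::finite + 'n)) set \<Rightarrow> bool" where
  "complex_lagrangian \<Gamma> \<longleftrightarrow>
     vec.subspace \<Gamma> \<and> vec.dim \<Gamma> = CARD('n) \<and> (\<forall>w\<in>\<Gamma>. \<forall>z\<in>\<Gamma>. omega w z = 0)"

definition s_form :: "complex^('n::finite + 'n) \<Rightarrow> complex^('n + 'n) \<Rightarrow> complex" where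
  "s_form w z = - \<i> * omega w (cnj_vec z)"

definition negative_lagrangian_grassmannian :: "(complex^('n::finite + 'n)) set set" where
  "negative_lagrangian_grassmannian =
     {\<Gamma>. complex_lagrangian \<Gamma> \<and>
          (\<forall>w\<in>\<Gamma>. w \<noteq> 0 \<longrightarrow> s_form w w \<in> \<real> \<and> Re (s_form w w) < 0)}"

definition Gamma1 :: "(complex^('n::finite + 'n)) set" where
  "Gamma1 = vec.span (range (\<lambda>\<alpha>. axis (Inl \<alpha>) 1))"

definition Gamma2 :: "(complex^('n::finite + 'n)) set" where
  "Gamma2 = vec.span (range (\<lambda>\<beta>. axis (Inr \<beta>) 1))"

definition proj1 :: "complex^('n::finite + 'n) \<Rightarrow> complex^('n + 'n)" where
  "proj1 w = (\<chi> i. case i of Inl \<alpha> \<Rightarrow> w $ Inl \<alpha> | Inr \<beta> \<Rightarrow> 0)"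

definition proj2 :: "complex^('n::finite + 'n) \<Rightarrow> complex^('n + 'n)" where
  "proj2 w = (\<chi> i. case i of Inl \<alpha> \<Rightarrow> 0 | Inr \<beta> \<Rightarrow> w $ Inr \<beta>)"

definition W_hat :: "(complex^('n::finite + 'n)) set \<Rightarrow> complex^('n + 'n) \<Rightarrow> complex^('n + 'n)" where
  "W_hat \<Gamma> = proj2 \<circ> inv_into \<Gamma> proj1"

text \<open>
  The coefficient of \<open>e\<^sub>n\<^sub>+\<^sub>\<beta>\<close> in \<open>W_hat \<Gamma> e\<^sub>\<alpha>\<close> is entry \<open>(\<beta>, \<alpha>)\<close>; see \<open>W_hat_expansion\<close> below.
\<close>

definition W_coord :: "(complex^('n::finite + 'n)) set \<Rightarrow> complex^'n^'n" where
  "W_coord \<Gamma> = (\<chi> \<beta> \<alpha>. W_hat \<Gamma> (axis (Inl \<alpha>) 1) $ Inr \<beta>)"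

lemma sum_UNIV_Plus:
  fixes f :: "'n::finite + 'm::finite \<Rightarrow> 'a::comm_monoid_add"
  shows "(\<Sum>i\<in>UNIV. f i) = (\<Sum>a\<in>UNIV. f (Inl a)) + (\<Sum>b\<in>UNIV. f (Inr b))"
proof -
  have "(\<Sum>i\<in>UNIV. f i) = sum f (UNIV <+> UNIV)" by simp
  also have "\<dots> = (\<Sum>a\<in>UNIV. f (Inl a)) + (\<Sum>b\<in>UNIV. f (Inr b))"
    by (subst sum.Plus) auto
  finally show ?thesis .
qed

lemma sum_if_mult:
  fixes x :: "'n::finite \<Rightarrow> 'a::comm_ring_1"
  shows "(\<Sum>b\<in>UNIV. (if a = b then 1 else 0) * x b) = x a"
    and "(\<Sum>b\<in>UNIV. - (if a = b then 1 else 0) * x b) = - x a"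
proof -
  have "(\<Sum>b\<in>UNIV. (if a = b then 1 else 0) * x b) = (\<Sum>b\<in>UNIV. if a = b then x b else 0)"
    by (rule sum.cong) auto
  then show *: "(\<Sum>b\<in>UNIV. (if a = b then 1 else 0) * x b) = x a" by simp
  have "(\<Sum>b\<in>UNIV. - (if a = b then 1 else 0) * x b) = - (\<Sum>b\<in>UNIV. (if a = b then 1 else 0) * x b)"
    by (simp only: sum_negf mult_minus_left)
  then show "(\<Sum>b\<in>UNIV. - (if a = b then 1 else 0) * x b) = - x a" by (simp only: *)
qed

lemma JJ_mult:
  fixes w :: "'a::comm_ring_1^('n::finite + 'n)"
  shows "(JJ *v w) $ Inl a = w $ Inr a" and "(JJ *v w) $ Inr a = - w $ Inl a"
  by (simp_all only: matrix_vector_mult_def JJ_def block_mat_def vec_lambda_beta sum_UNIV_Plus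
      sum.case mat_def sum_if_mult vector_uminus_component)
    (simp_all add: sum.neutral)

lemma omega_blocks:
  fixes v w :: "'a::comm_ring_1^('n::finite + 'n)"
  shows "omega v w = (\<Sum>a\<in>UNIV. v $ Inl a * w $ Inr a) - (\<Sum>a\<in>UNIV. v $ Inr a * w $ Inl a)"
  by (simp add: omega_def sum_UNIV_Plus JJ_mult sum_negf)

lemma axis_expansion: "w = (\<Sum>i\<in>UNIV. w $ i *s axis i (1::complex))"
  by (simp add: basis_expansion)

lemma proj1_expansion: "proj1 w = (\<Sum>\<alpha>\<in>UNIV. w $ Inl \<alpha> *s axis (Inl \<alpha>) 1)"
  by (subst axis_expansion) (simp add: sum_UNIV_Plus proj1_def)

lemma proj2_expansion: "proj2 w = (\<Sum>\<beta>\<in>UNIV. w $ Inr \<beta> *s axis (Inr \<beta>) 1)"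
  by (subst axis_expansion) (simp add: sum_UNIV_Plus proj2_def)

lemma proj1_in: "proj1 w \<in> Gamma1"
  unfolding proj1_expansion Gamma1_def
  by (intro vec.span_sum vec.span_scale vec.span_base rangeI)

lemma proj2_in: "proj2 w \<in> Gamma2"
  unfolding proj2_expansion Gamma2_def
  by (intro vec.span_sum vec.span_scale vec.span_base rangeI)

lemma proj_sum: "w = proj1 w + proj2 w"
  by (simp add: vec_eq_iff proj1_def proj2_def split: sum.split)

lemma W_hat_expansion:
  fixes \<Gamma> :: "(complex^('n::finite + 'n)) set"
  shows "W_hat \<Gamma> (axis (Inl \<alpha>) 1) = (\<Sum>\<beta>\<in>UNIV. W_coord \<Gamma> $ \<beta> $ \<alpha> *s axis (Inr \<beta>) 1)"
proof -
  have "proj2 (proj2 w) = proj2 w" for w :: "complex^('n + 'n)"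
    by (simp add: proj2_def vec_eq_iff split: sum.split)
  then have "W_hat \<Gamma> (axis (Inl \<alpha>) 1) = proj2 (W_hat \<Gamma> (axis (Inl \<alpha>) 1))"
    by (simp add: W_hat_def)
  then show ?thesis by (simp add: proj2_expansion W_coord_def)
qed

lemma linear_proj1: "Vector_Spaces.linear (*s) (*s) proj1"
  by unfold_locales (auto simp: proj1_def vec_eq_iff split: sum.split)

lemma dim_Gamma1: "vec.dim (Gamma1 :: (complex^('n::finite + 'n)) set) = CARD('n)"
proof -
  let ?B = "range (\<lambda>\<alpha>. axis (Inl \<alpha>) 1) :: (complex^('n + 'n)) set"
  have "vec.independent ?B"
    by (rule vec.independent_mono[OF independent_cart_basis]) (auto simp: cart_basis_def)
  moreover have "card ?B = CARD('n)"
    by (rule card_image) (auto simp: inj_on_def axis_eq_axis)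
  ultimately show ?thesis
    by (simp add: Gamma1_def vec.dim_eq_card_independent)
qed

lemma bij_betw_proj1:
  fixes \<Gamma> :: "(complex^('n::finite + 'n)) set"
  assumes "\<Gamma> \<in> negative_lagrangian_grassmannian"
  shows "bij_betw proj1 \<Gamma> Gamma1"
proof -
  interpret p: Vector_Spaces.linear "(*s)" "(*s)" "proj1 :: complex^('n + 'n) \<Rightarrow> _"
    by (rule linear_proj1)
  have sub: "vec.subspace \<Gamma>" and dim: "vec.dim \<Gamma> = CARD('n)"
    and neg: "\<And>w. w \<in> \<Gamma> \<Longrightarrow> w \<noteq> 0 \<Longrightarrow> Re (s_form w w) < 0"
    using assms by (auto simp: negative_lagrangian_grassmannian_def complex_lagrangian_def)
  have "w = 0" if "w \<in> \<Gamma>" "proj1 w = 0" for w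
  proof (rule ccontr)
    assume "w \<noteq> 0"
    have "w $ Inl a = 0" for a
    proof -
      have "proj1 w $ Inl a = 0" using that by simp
      then show ?thesis by (simp add: proj1_def)
    qed
    then have "s_form w w = 0" by (simp add: s_form_def omega_blocks cnj_vec_def)
    with neg[OF that(1) \<open>w \<noteq> 0\<close>] show False by simp
  qed
  then have inj: "inj_on proj1 \<Gamma>"
    using p.inj_on_iff_eq_0[OF sub] by blast
  have span: "vec.span \<Gamma> = \<Gamma>" using sub by (simp add: vec.span_eq_iff)
  then have d: "vec.dim (proj1 ` \<Gamma>) = vec.dim \<Gamma>"
    by (intro vec.dim_image_eq[OF linear_proj1]) (simp only: span inj)
  have "proj1 ` \<Gamma> = Gamma1"
  proof (rule vec.subspace_dim_equal)
    show "vec.subspace (proj1 ` \<Gamma>)" by (rule p.subspace_image[OF sub])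
    show "vec.subspace (Gamma1 :: (complex^('n + 'n)) set)"
      unfolding Gamma1_def by (rule vec.subspace_span)
    show "proj1 ` \<Gamma> \<subseteq> Gamma1" using proj1_in by blast
    show "vec.dim (Gamma1 :: (complex^('n + 'n)) set) \<le> vec.dim (proj1 ` \<Gamma>)"
      using d dim dim_Gamma1[where 'n='n] by simp
  qed
  with inj show ?thesis by (simp add: bij_betw_def)
qed

end

theory Submission
  imports Defs
begin

text \<open>
  Since \<open>j S = - S J\<close>, the \<open>(-i)\<close>-eigenspace of \<open>j\<close> is the image under \<open>S\<close> of the \<open>i\<close>-eigenspace
  \<open>{(x, i x)}\<close> of \<open>J\<close>, that is \<open>{(A x, B x)}\<close> with \<open>A = Q\<^sub>1 + i Q\<^sub>2\<close> and \<open>B = P\<^sub>1 + i P\<^sub>2\<close>.  The complexified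
  \<open>S\<close> is symplectic and commutes with conjugation, so the Lagrangian and negativity conditions need
  only be checked on \<open>{(x, i x)}\<close>.  If \<open>A x = 0\<close> then \<open>(0, B x)\<close> is isotropic for the negative form,
  hence zero; so \<open>A\<close> is invertible and the subspace is the graph of \<open>B A\<^sup>-\<^sup>1\<close>.
\<close>

section \<open>Signs, and real matrices acting on complex vectors\<close>

lemma matrix_mul_uminus_left: "(- A) ** B = - (A ** (B :: 'a::ring_1^'m^'k::finite))"
  by (simp add: matrix_matrix_mult_def vec_eq_iff sum_negf)

lemma matrix_mul_uminus_right: "A ** (- B) = - (A ** (B :: 'a::ring_1^'m^'k::finite))"
  by (simp add: matrix_matrix_mult_def vec_eq_iff sum_negf)

lemma matrix_vector_mul_uminus_left: "(- A) *v x = - (A *v (x :: 'a::ring_1^'k::finite))"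
  by (simp add: matrix_vector_mult_def vec_eq_iff sum_negf)

lemma matrix_vector_mult_axis: "(M *v axis a (1 :: 'a::comm_semiring_1)) $ b = M $ b $ a"
  by (simp add: matrix_vector_mult_def axis_def if_distrib cong: if_cong)

lemma transpose_uminus: "transpose (- A) = - transpose A"
  by (simp add: transpose_def vec_eq_iff)

lemma cmat_mult: "cmat (A ** B) = cmat A ** cmat B"
  by (simp add: matrix_matrix_mult_def vec_eq_iff)

lemma cmat_uminus: "cmat (- A) = - cmat A"
  by (simp add: vec_eq_iff)

lemma cmat_transpose: "cmat (transpose A) = transpose (cmat A)"
  by (simp add: transpose_def vec_eq_iff)

lemma cmat_JJ: "cmat (JJ :: real^('n::finite + 'n)^('n + 'n)) = JJ"
  by (simp add: JJ_def block_mat_def vec_eq_iff mat_def split: sum.split)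

lemma cmat_mult_cvec: "cmat M *v cvec a = cvec (M *v a)"
  by (simp add: matrix_vector_mult_def vec_eq_iff cvec_def)

lemma cmat_mult_complex:
  "cmat M *v (cvec a + \<i> *s cvec b) = cvec (M *v a) + \<i> *s cvec (M *v b)"
  by (simp only: matrix_vector_right_distrib vector_scalar_commute cmat_mult_cvec)

text \<open>The entries are real. This lets a real symplectic matrix preserve the sesquilinear
  \<open>s_form\<close> as well as the bilinear \<open>omega\<close>.\<close>

lemma cmat_mult_cnj: "cnj_vec (cmat M *v w) = cmat M *v cnj_vec w"
  by (simp add: matrix_vector_mult_def vec_eq_iff cnj_vec_def)

lemma mat_scale_vector_mult: "mat_scale c A *v x = (c :: 'a::comm_semiring_1) *s (A *v x)"
  by (simp add: mat_scale_def matrix_vector_mult_def vec_eq_iff sum_distrib_left mult_ac)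

lemma cvec_decomposition:
  obtains a b where "w = cvec a + \<i> *s cvec b"
proof
  show "w = cvec (\<chi> i. Re (w $ i)) + \<i> *s cvec (\<chi> i. Im (w $ i))"
    by (simp add: vec_eq_iff cvec_def complex_eq)
qed

section \<open>The matrix \<open>JJ\<close> and symplectic matrices\<close>

lemma JJ_JJ: "JJ ** JJ = - (mat 1 :: 'a::comm_ring_1^('n::finite + 'n)^('n + 'n))"
proof -
  have "(JJ ** JJ) *v w = - mat 1 *v w" for w :: "'a^('n + 'n)"
  proof -
    have "(JJ *v (JJ *v w)) $ i = (- w) $ i" for i
      by (cases i) (simp_all add: JJ_mult)
    then show ?thesis
      by (simp add: vec_eq_iff matrix_vector_mul_assoc matrix_vector_mul_uminus_left)
  qed
  then show ?thesis by (simp add: matrix_eq)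
qed

lemma transpose_JJ: "transpose JJ = - (JJ :: 'a::comm_ring_1^('n::finite + 'n)^('n + 'n))"
  by (simp add: transpose_def JJ_def block_mat_def vec_eq_iff mat_def split: sum.split)

text \<open>Transposition moves \<open>M\<close> to the other side of the dot product. The right
  side stays a plain dot product because it serves both the invariance of \<open>omega\<close> and
  the positivity of \<open>omega u (j *v u)\<close>.\<close>

lemma omega_mult:
  fixes M :: "'a::comm_ring_1^('n::finite + 'n)^('n + 'n)"
  shows "omega (M *v v) w = (\<Sum>i\<in>UNIV. v $ i * (transpose M *v (JJ *v w)) $ i)"
proof -
  have "(\<Sum>i\<in>UNIV. (\<Sum>k\<in>UNIV. M $ i $ k * v $ k) * x $ i)
      = (\<Sum>k\<in>UNIV. v $ k * (\<Sum>i\<in>UNIV. M $ i $ k * x $ i))" for x :: "'a^('n + 'n)"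
    by (simp add: sum_distrib_left sum_distrib_right mult_ac) (rule sum.swap)
  from this[of "JJ *v w"] show ?thesis
    by (simp only: omega_def matrix_vector_mult_def[of M] matrix_vector_mult_def[of "transpose M"]
        vec_lambda_beta) (simp only: transpose_def vec_lambda_beta)
qed

lemma omega_symplectic:
  fixes M :: "'a::comm_ring_1^('n::finite + 'n)^('n + 'n)"
  assumes "transpose M ** JJ ** M = JJ"
  shows "omega (M *v v) (M *v w) = omega v w"
  unfolding omega_mult matrix_vector_mul_assoc matrix_mul_assoc assms unfolding omega_def ..

text \<open>The hypothesis says that \<open>- (JJ ** transpose S ** JJ)\<close> is a left inverse of
  \<open>S\<close>. For square matrices it is also a right inverse, and multiplying that identity by
  \<open>JJ\<close> on the right isolates \<open>S ** JJ ** transpose S\<close>.\<close>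

lemma symplectic_transpose:
  fixes S :: "real^('n::finite + 'n)^('n + 'n)"
  assumes "transpose S ** JJ ** S = JJ"
  shows "S ** JJ ** transpose S = JJ"
proof -
  have "(- (JJ ** transpose S ** JJ)) ** S = - (JJ ** (transpose S ** JJ ** S))"
    by (simp add: matrix_mul_uminus_left matrix_mul_assoc)
  also have "\<dots> = mat 1" by (simp add: assms JJ_JJ)
  finally have "S ** (- (JJ ** transpose S ** JJ)) = mat 1"
    using matrix_left_right_inverse by blast
  then have "- (S ** JJ ** transpose S ** JJ) ** JJ = mat 1 ** JJ"
    by (simp add: matrix_mul_uminus_right matrix_mul_assoc)
  then have "- (S ** JJ ** transpose S ** (JJ ** JJ)) = JJ"
    by (simp add: matrix_mul_uminus_left matrix_mul_assoc)
  then show ?thesis by (simp add: JJ_JJ matrix_mul_uminus_right)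
qed

section \<open>The compatible complex structure of a symplectic matrix\<close>

lemma j_Sp_intertwines:
  assumes "S \<in> Sp"
  shows "j_Sp S ** S = - (S ** JJ)"
proof -
  have "S ** transpose S ** JJ ** S = S ** (transpose S ** JJ ** S)"
    by (simp add: matrix_mul_assoc)
  then show ?thesis
    using assms by (simp add: j_Sp_def matrix_mul_uminus_left Sp_def)
qed

lemma j_Sp_compatible:
  fixes S :: "real^('n::finite + 'n)^('n + 'n)"
  assumes "S \<in> Sp"
  shows "compatible_complex_structure (j_Sp S)"
proof -
  have SJS: "transpose S ** JJ ** S = JJ" using assms by (simp add: Sp_def)
  note SJS' = symplectic_transpose[OF SJS]
  let ?j = "j_Sp S"
  have sq: "?j ** ?j = - mat 1"
  proof -
    \<comment> \<open>Only the second factor is expanded, so that \<open>?j ** S\<close> appears and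
      the intertwining relation applies.\<close>
    have "?j ** ?j = - (?j ** S ** transpose S ** JJ)"
      by (simp add: j_Sp_def matrix_mul_uminus_right matrix_mul_assoc)
    also have "\<dots> = S ** JJ ** transpose S ** JJ"
      by (simp add: j_Sp_intertwines[OF assms] matrix_mul_uminus_left)
    finally show ?thesis by (simp add: SJS' JJ_JJ)
  qed
  have tj: "transpose ?j = JJ ** S ** transpose S"
    by (simp add: j_Sp_def transpose_uminus matrix_transpose_mul transpose_JJ
        matrix_mul_uminus_left matrix_mul_assoc)
  \<comment> \<open>The bracketed product is \<open>- ?j\<close>, so being symplectic reduces to
    \<open>?j ** ?j = - mat 1\<close>.\<close>
  have "transpose ?j ** JJ ** ?j = JJ ** (S ** transpose S ** JJ) ** ?j"
    by (simp add: tj matrix_mul_assoc)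
  also have "S ** transpose S ** JJ = - ?j" by (simp add: j_Sp_def)
  also have "JJ ** (- ?j) ** ?j = - (JJ ** (?j ** ?j))"
    by (simp add: matrix_mul_uminus_left matrix_mul_uminus_right matrix_mul_assoc)
  also have "\<dots> = JJ" by (simp add: sq matrix_mul_uminus_right)
  finally have "?j \<in> Sp" by (simp add: Sp_def)
  moreover have "omega u (?j *v u) > 0" if "u \<noteq> 0" for u
  proof -
    \<comment> \<open>With this \<open>y\<close>, \<open>?j *v u\<close> is
      \<open>- (S *v y)\<close>. Antisymmetry of \<open>omega\<close> and moving \<open>S\<close>
      across then turn \<open>omega u (?j *v u)\<close> into the squared norm of
      \<open>y\<close>.\<close>
    define y where "y = transpose S *v (JJ *v u)"
    have ju: "?j *v u = - (S *v y)"
      by (simp only: j_Sp_def y_def matrix_vector_mul_uminus_left matrix_vector_mul_assoc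
          matrix_mul_assoc)
    have "omega u (?j *v u) = omega (S *v y) u"
      by (simp add: ju omega_blocks sum_negf mult.commute)
    also have "\<dots> = y \<bullet> y"
      by (simp add: omega_mult y_def[symmetric] inner_vec_def del: transpose_matrix_vector)
    finally have *: "omega u (?j *v u) = y \<bullet> y" .
    have "y \<noteq> 0"
    proof
      assume "y = 0"
      then have "?j *v u = 0" by (simp add: ju)
      then have "(?j ** ?j) *v u = 0" by (simp flip: matrix_vector_mul_assoc)
      with that show False by (simp add: sq matrix_vector_mul_uminus_left)
    qed
    with * show ?thesis by simp
  qed
  ultimately show ?thesis by (simp add: compatible_complex_structure_def sq)
qed

section \<open>Eigenspaces of \<open>j\<close> and of \<open>JJ\<close>\<close>

lemma Gamma_of_eigenspace:
  fixes j :: "real^('n::finite + 'n)^('n + 'n)"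
  assumes sq: "j ** j = - mat 1"
  shows "Gamma_of j = {w. cmat j *v w = (- \<i>) *s w}"
proof -
  have jj: "j *v (j *v v) = - v" for v
    by (simp add: matrix_vector_mul_assoc sq matrix_vector_mul_uminus_left)
  \<comment> \<open>The factor 1/2 is absorbed into the real vector, so \<open>Gamma_of j\<close>
    consists of the vectors a + i j a with a real.\<close>
  have elem: "mat_scale (1/2) (mat 1 + mat_scale \<i> (cmat j)) *v cvec v
      = cvec (v /\<^sub>R 2) + \<i> *s cvec (j *v (v /\<^sub>R 2))" for v
  proof -
    have "mat_scale (1/2) (mat 1 + mat_scale \<i> (cmat j)) *v cvec v
        = (1/2) *s (mat 1 *v cvec v + \<i> *s (cmat j *v cvec v))"
      by (simp only: mat_scale_vector_mult matrix_vector_mult_add_rdistrib)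
    also have "\<dots> = (1/2) *s (cvec v + \<i> *s cvec (j *v v))"
      by (simp only: cmat_mult_cvec matrix_vector_mul_lid)
    also have "\<dots> = cvec (v /\<^sub>R 2) + \<i> *s cvec (j *v (v /\<^sub>R 2))"
      by (simp add: vec_eq_iff cvec_def matrix_vector_mult_scaleR algebra_simps)
    finally show ?thesis .
  qed
  show ?thesis
  proof (intro equalityI subsetI)
    fix w assume "w \<in> Gamma_of j"
    then obtain a where w: "w = cvec a + \<i> *s cvec (j *v a)"
      unfolding Gamma_of_def elem by blast
    show "w \<in> {w. cmat j *v w = (- \<i>) *s w}"
      by (simp only: w mem_Collect_eq cmat_mult_complex jj)
        (simp add: vec_eq_iff cvec_def algebra_simps)
  next
    fix w assume "w \<in> {w. cmat j *v w = (- \<i>) *s w}"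
    then have eig: "cmat j *v w = (- \<i>) *s w" by simp
    obtain a b where w: "w = cvec a + \<i> *s cvec b" by (rule cvec_decomposition)
    have "cvec (j *v a) + \<i> *s cvec (j *v b) = (- \<i>) *s (cvec a + \<i> *s cvec b)"
      using eig by (simp only: w cmat_mult_complex)
    \<comment> \<open>This is the real part of the eigenvalue equation. Below,
      \<open>2 *\<^sub>R a\<close> is the preimage, which cancels the factor 1/2.\<close>
    then have "b = j *v a"
      by (simp add: vec_eq_iff cvec_def complex_eq_iff)
    then have "w = cvec ((2 *\<^sub>R a) /\<^sub>R 2) + \<i> *s cvec (j *v ((2 *\<^sub>R a) /\<^sub>R 2))"
      by (simp add: w)
    then show "w \<in> Gamma_of j"
      unfolding Gamma_of_def elem by blast
  qed
qed

definition i_eigenvector :: "complex^'n \<Rightarrow> complex^('n::finite + 'n)" where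
  "i_eigenvector x = (\<chi> k. case k of Inl a \<Rightarrow> x $ a | Inr a \<Rightarrow> \<i> * x $ a)"

lemma i_eigenvector_nth [simp]:
  "i_eigenvector x $ Inl a = x $ a" "i_eigenvector x $ Inr a = \<i> * x $ a"
  by (simp_all add: i_eigenvector_def)

text \<open>The first block of the eigenvalue equation already determines the second half of v from
  the first; the second block then holds because the square of i is -1.\<close>

lemma JJ_eigenspace: "{v. JJ *v v = \<i> *s v} = range i_eigenvector"
proof (intro equalityI subsetI)
  fix v :: "complex^('n::finite + 'n)" assume v: "v \<in> {v. JJ *v v = \<i> *s v}"
  have "v $ Inr a = \<i> * v $ Inl a" for a
    using v JJ_mult(1)[of v a] by simp
  then have "v $ k = i_eigenvector (\<chi> a. v $ Inl a) $ k" for k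
    by (cases k) simp_all
  then show "v \<in> range i_eigenvector"
    by (metis rangeI vec_eq_iff)
next
  fix v :: "complex^('n::finite + 'n)" assume "v \<in> range i_eigenvector"
  then obtain x where v: "v = i_eigenvector x" by blast
  have "(JJ *v v) $ k = (\<i> *s v) $ k" for k
    by (cases k) (simp_all add: v JJ_mult)
  then show "v \<in> {v. JJ *v v = \<i> *s v}" by (simp add: vec_eq_iff)
qed

text \<open>The factor i in the lower half of the vector multiplies the second block column, which
  is how the combinations Q1 + i Q2 and P1 + i P2 arise.\<close>

lemma block_mat_i_eigenvector:
  fixes Q1 Q2 P1 P2 :: "real^'n::finite^'n"
  shows "(cmat (block_mat Q1 Q2 P1 P2) *v i_eigenvector x) $ Inl a
      = ((cmat Q1 + mat_scale \<i> (cmat Q2)) *v x) $ a"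
    and "(cmat (block_mat Q1 Q2 P1 P2) *v i_eigenvector x) $ Inr a
      = ((cmat P1 + mat_scale \<i> (cmat P2)) *v x) $ a"
  by (simp_all add: matrix_vector_mult_def sum_UNIV_Plus block_mat_def mat_scale_def
      sum.distrib algebra_simps)

section \<open>Parametrization of \<open>Gamma_of j\<close> and its upper half plane
  coordinate\<close>

theorem mainTheorem4:
  fixes Q1 Q2 P1 P2 :: "real^'n::finite^'n" and S j :: "real^('n + 'n)^('n + 'n)"
  assumes "S = block_mat Q1 Q2 P1 P2" and "S \<in> Sp" and "j = j_Sp S"
  shows "compatible_complex_structure j
    \<and> Gamma_of j = {w. cmat j *v w = (- \<i>) *s w}
    \<and> Gamma_of j \<in> negative_lagrangian_grassmannian
    \<and> invertible (cmat Q1 + mat_scale \<i> (cmat Q2))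
    \<and> W_coord (Gamma_of j)
        = (cmat P1 + mat_scale \<i> (cmat P2)) ** matrix_inv (cmat Q1 + mat_scale \<i> (cmat Q2))"
proof -
  define A where "A = cmat Q1 + mat_scale \<i> (cmat Q2)"
  define B where "B = cmat P1 + mat_scale \<i> (cmat P2)"
  define F where "F x = cmat S *v i_eigenvector x" for x
  have F_nth: "F x $ Inl a = (A *v x) $ a" "F x $ Inr a = (B *v x) $ a" for x a
    unfolding F_def A_def B_def assms(1) by (rule block_mat_i_eigenvector)+
  have compat: "compatible_complex_structure j"
    using j_Sp_compatible assms by blast
  then have eigen: "Gamma_of j = {w. cmat j *v w = (- \<i>) *s w}"
    by (intro Gamma_of_eigenspace) (simp add: compatible_complex_structure_def)
  have "transpose S ** JJ ** S = JJ" using assms(2) by (simp add: Sp_def)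
  then have symp: "transpose (cmat S) ** JJ ** cmat S = JJ"
    by (metis cmat_JJ cmat_mult cmat_transpose)
  have "(- (JJ ** transpose (cmat S) ** JJ)) ** cmat S
      = - (JJ ** (transpose (cmat S) ** JJ ** cmat S))"
    by (simp add: matrix_mul_uminus_left matrix_mul_assoc)
  then have linv: "(- (JJ ** transpose (cmat S) ** JJ)) ** cmat S = mat 1"
    by (simp add: symp JJ_JJ)
  then have invS: "invertible (cmat S)" using invertible_left_inverse by blast
  have injS: "inj ((*v) (cmat S))" by (rule inj_matrix_vector_mult[OF invS])
  have "cmat j ** cmat S = - (cmat S ** JJ)"
    by (metis assms(2,3) cmat_JJ cmat_mult cmat_uminus j_Sp_intertwines)
  then have jS: "cmat j *v (cmat S *v v) = - (cmat S *v (JJ *v v))" for v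
    by (simp add: matrix_vector_mul_assoc matrix_vector_mul_uminus_left)
  \<comment> \<open>By \<open>jS\<close> both sides carry the factor \<open>cmat S\<close>;
    cancelling it leaves the eigenvalue equation of \<open>JJ\<close> for i.\<close>
  have iff: "cmat j *v (cmat S *v v) = (- \<i>) *s (cmat S *v v) \<longleftrightarrow> v \<in> range i_eigenvector" for v
  proof -
    have "(- \<i>) *s (cmat S *v v) = - (cmat S *v (\<i> *s v))"
      by (metis vector_scalar_commute vector_smult_lneg)
    then have "cmat j *v (cmat S *v v) = (- \<i>) *s (cmat S *v v)
        \<longleftrightarrow> cmat S *v (JJ *v v) = cmat S *v (\<i> *s v)"
      by (simp only: jS neg_equal_iff_equal)
    also have "\<dots> \<longleftrightarrow> v \<in> range i_eigenvector"
      unfolding JJ_eigenspace[symmetric] by (simp add: inj_eq[OF injS])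
    finally show ?thesis .
  qed
  have surjS: "\<exists>v. w = cmat S *v v" for w
    using invS by (metis invertible_right_inverse matrix_vector_mul_assoc matrix_vector_mul_lid)
  have range: "Gamma_of j = range F"
  proof (intro equalityI subsetI)
    fix w assume w: "w \<in> Gamma_of j"
    obtain v where v: "w = cmat S *v v" using surjS by blast
    with w show "w \<in> range F" by (auto simp only: eigen F_def mem_Collect_eq iff)
  next
    fix w assume "w \<in> range F"
    then show "w \<in> Gamma_of j"
      by (auto simp only: eigen F_def mem_Collect_eq iff intro: rangeI)
  qed
  have injF: "inj F"
  proof (rule injI)
    fix x y assume "F x = F y"
    then have "i_eigenvector x = i_eigenvector y"
      unfolding F_def by (rule injD[OF injS])
    then show "x = y" by (metis i_eigenvector_nth(1) vec_eq_iff)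
  qed
  have linF: "Vector_Spaces.linear (*s) (*s) F"
  proof unfold_locales
    fix x y :: "complex^'n" and c :: complex
    have "F (x + y) $ k = (F x + F y) $ k" for k
      by (cases k) (simp_all add: F_nth matrix_vector_right_distrib)
    then show "F (x + y) = F x + F y" by (simp add: vec_eq_iff)
    have "F (c *s x) $ k = (c *s F x) $ k" for k
      by (cases k) (simp_all add: F_nth vector_scalar_commute)
    then show "F (c *s x) = c *s F x" by (simp add: vec_eq_iff)
  qed
  interpret F: Vector_Spaces.linear "(*s)" "(*s)" F by (rule linF)
  \<comment> \<open>The invariance of \<open>omega\<close> removes \<open>S\<close>. On (x, i x)
    each of the two sums in \<open>omega\<close> contributes -i times the squared norm of x, hence
    the factor -2.\<close>
  have neg: "s_form (F x) (F x) = - 2 * complex_of_real (\<Sum>a\<in>UNIV. (cmod (x $ a))\<^sup>2)" for x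
  proof -
    have "s_form (F x) (F x) = - \<i> * omega (i_eigenvector x) (cnj_vec (i_eigenvector x))"
      by (simp add: s_form_def F_def cmat_mult_cnj omega_symplectic[OF symp])
    also have "\<dots> = - 2 * (\<Sum>a\<in>UNIV. x $ a * cnj (x $ a))"
      by (simp add: omega_blocks cnj_vec_def sum_negf sum_distrib_left algebra_simps)
    finally show ?thesis by (simp only: of_real_sum complex_norm_square)
  qed
  have "Gamma_of j \<in> negative_lagrangian_grassmannian"
    unfolding range negative_lagrangian_grassmannian_def complex_lagrangian_def
  proof (intro CollectI conjI ballI impI)
    show "vec.subspace (range F)"
      using F.subspace_image[OF vec.subspace_UNIV] .
    have "vec.dim (range F) = vec.dim (UNIV :: (complex^'n) set)"
      by (rule vec.dim_image_eq[OF linF]) (simp add: injF)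
    then show "vec.dim (range F) = CARD('n)" by (simp only: vec_dim_card)
  next
    fix w z assume "w \<in> range F" "z \<in> range F"
    then obtain x y where "w = F x" "z = F y" by blast
    then have "omega w z = omega (i_eigenvector x) (i_eigenvector y)"
      by (simp add: F_def omega_symplectic[OF symp])
    then show "omega w z = 0" by (simp add: omega_blocks mult_ac)
  next
    fix w assume "w \<in> range F" and "w \<noteq> 0"
    then obtain x where w: "w = F x" and "x \<noteq> 0" using F.zero by blast
    then obtain a where "x $ a \<noteq> 0" by (auto simp: vec_eq_iff)
    then have "(\<Sum>a\<in>UNIV. (cmod (x $ a))\<^sup>2) > 0"
      by (intro sum_pos2[of _ a]) auto
    then show "s_form w w \<in> \<real>" "Re (s_form w w) < 0"
      unfolding w neg by (simp_all del: of_real_sum of_real_power)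
  qed
  moreover from bij_betw_proj1[OF this] have inj: "inj_on proj1 (range F)"
    by (simp add: range bij_betw_def)
  moreover have invA: "invertible A"
  proof -
    \<comment> \<open>If A x = 0, then F x and F 0 have the same first projection. Injectivity of
      \<open>proj1\<close> on the negative Lagrangian subspace and of \<open>F\<close> then gives x
      = 0.\<close>
    have "x = 0" if "A *v x = 0" for x
    proof -
      have "proj1 (F x) = proj1 (F 0)"
        by (simp add: proj1_def vec_eq_iff F_nth that split: sum.split)
      with inj have "F x = F 0" by (rule inj_onD) (rule rangeI)+
      then show ?thesis by (rule injD[OF injF])
    qed
    then show ?thesis
      using invertible_left_inverse matrix_left_invertible_ker by blast
  qed
  moreover have "W_coord (Gamma_of j) = B ** matrix_inv A"
  proof -
    have "W_hat (range F) (axis (Inl \<alpha>) 1) $ Inr \<beta> = (B ** matrix_inv A) $ \<beta> $ \<alpha>" for \<alpha> \<beta>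
    proof -
      \<comment> \<open>Chosen so that A x is the basis vector at \<alpha>: \<open>F x\<close> is
        then the unique point of the subspace over \<open>axis (Inl \<alpha>) 1\<close>, and its
        lower half B x is column \<alpha> of the coordinate matrix.\<close>
      define x where "x = matrix_inv A *v axis \<alpha> 1"
      have "A ** matrix_inv A = mat 1"
        \<comment> \<open>\<open>matrix_inv\<close> is a choice operator, so its defining property
          is available only through the existence of an inverse.\<close>
        using invA unfolding invertible_def matrix_inv_def by (rule someI2_ex) simp
      then have "A *v x = axis \<alpha> 1"
        by (simp add: x_def matrix_vector_mul_assoc)
      then have "proj1 (F x) = axis (Inl \<alpha>) 1"
        by (simp add: proj1_def vec_eq_iff F_nth axis_def split: sum.split)
      then have "inv_into (range F) proj1 (axis (Inl \<alpha>) 1) = F x"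
        using inv_into_f_f[OF inj, of "F x"] by simp
      then have "W_hat (range F) (axis (Inl \<alpha>) 1) $ Inr \<beta> = (B *v x) $ \<beta>"
        by (simp add: W_hat_def proj2_def F_nth)
      then show ?thesis
        by (simp add: x_def matrix_vector_mul_assoc matrix_vector_mult_axis)
    qed
    then show ?thesis by (simp add: W_coord_def range vec_eq_iff)
  qed
  ultimately show ?thesis
    using compat eigen by (simp add: A_def B_def)
qed

end
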